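(* Let $f:\mathbb{N}\to\mathbb{N}$ be a function. Then $f$ is $\mathbb{Z}$-rational if and only if there exist two $\mathbb{N}$-rational functions $f_1,f_2:\mathbb{N}\to\mathbb{N}$ such that $f(n)=f_1(n)-f_2(n)$ for all $n\in\mathbb{N}$.
   Context: $\mathbb{N}=\{0,1,2,\ldots\}$. Let $A$ be a commutative semiring with unity. A formal power series $F=\sum_{n\ge 0} f(n)x^n$ in one variable over $A$ is $A$-rational if it lies in the smallest set of power series over $A$ containing the polynomials over $A$ and closed under sum, product, and the star operation $F^*=\sum_{i=0}^\infty F^i$ (applied to series $F$ with zero constant term, so that $F^*$ is well defined). A function $f:\mathbb{N}\to A$ is $A$-rational if $(f(n))_{n\ge 0}$ is the sequence of coefficients of an $A$-rational series. A function $f:\mathbb{N}\to\mathbb{N}$ is called $\mathbb{Z}$-rational if it is so when regarded as a function $\mathbb{N}\to\mathbb{Z}$. *)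

theory Defs
  imports "HOL-Computational_Algebra.Polynomial_FPS"
begin

text \<open>
  The formal sum of all powers of \<open>F\<close>.  It is meaningful only if \<open>F\<close> has constant term zero:
  then \<open>F ^ i\<close> has no coefficient below degree \<open>i\<close>, so the \<open>n\<close>-th coefficient of the
  infinite sum is that of the sum of the powers up to \<open>n\<close>.
\<close>

definition fps_star :: "'a::comm_semiring_1 fps \<Rightarrow> 'a fps" where
  "fps_star F = Abs_fps (\<lambda>n. \<Sum>i\<le>n. fps_nth (F ^ i) n)"

lemma fps_power_nth_below_zero:
  fixes F :: "'a::comm_semiring_1 fps"
  assumes "fps_nth F 0 = 0" and "n < i"
  shows "fps_nth (F ^ i) n = 0"
  using assms(2)
proof (induction i arbitrary: n)
  case 0
  then show ?case by simp
next
  case (Suc i)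
  have "fps_nth F k * fps_nth (F ^ i) (n - k) = 0" if "k \<le> n" for k
  proof (cases "k = 0")
    case True
    then show ?thesis using assms(1) by simp
  next
    case False
    then have "n - k < i" using Suc.prems that by linarith
    then show ?thesis using Suc.IH by simp
  qed
  then show ?case by (simp add: fps_mult_nth)
qed

lemma fps_star_nth_eq_partial_sum:
  fixes F :: "'a::comm_semiring_1 fps"
  assumes "fps_nth F 0 = 0" and "n \<le> N"
  shows "fps_nth (\<Sum>i\<le>N. F ^ i) n = fps_nth (fps_star F) n"
proof -
  have "(\<Sum>i\<le>N. fps_nth (F ^ i) n) = (\<Sum>i\<le>n. fps_nth (F ^ i) n)"
    using assms by (intro sum.mono_neutral_right) (auto simp: fps_power_nth_below_zero)
  then show ?thesis by (simp add: fps_star_def fps_sum_nth)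
qed

inductive_set rational_fps :: "'a::comm_semiring_1 fps set" where
  poly: "fps_of_poly p \<in> rational_fps"
| add: "F \<in> rational_fps \<Longrightarrow> G \<in> rational_fps \<Longrightarrow> F + G \<in> rational_fps"
| mult: "F \<in> rational_fps \<Longrightarrow> G \<in> rational_fps \<Longrightarrow> F * G \<in> rational_fps"
| star: "F \<in> rational_fps \<Longrightarrow> fps_nth F 0 = 0 \<Longrightarrow> fps_star F \<in> rational_fps"

text \<open>The semiring is the codomain type of the function.\<close>

definition rational_fun :: "(nat \<Rightarrow> 'a::comm_semiring_1) \<Rightarrow> bool" where
  "rational_fun f \<longleftrightarrow> Abs_fps f \<in> rational_fps"

end

(* Over the integers, differences of images of nat-rational series are closed under the rational
   operations; only the star of G - H needs an argument.  Both constant terms can be taken to be 0,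
   since a rational series stays rational over the naturals when its constant term is removed.
   Then, with K = H G*,
     1/(1 - G + H) = 1/(1 - G) * 1/(1 + K) = G* (1 - K) (K^2)*. *)
theory Submission
  imports Defs
begin

text \<open>In degree \<open>n\<close> the star agrees with any partial sum of powers that reaches
  \<open>n\<close>, and taking the zeroth power out of the sum up to \<open>Suc n\<close> leaves
  \<open>F\<close> times the sum up to \<open>n\<close>. The equation avoids subtraction, so it can
  be used over the naturals.\<close>

lemma fps_star_unfold:
  fixes F :: "'a::comm_semiring_1 fps"
  assumes "fps_nth F 0 = 0"
  shows "fps_star F = 1 + F * fps_star F"
proof (rule fps_ext)
  fix n
  have "fps_nth (fps_star F) n = fps_nth (\<Sum>i\<le>Suc n. F ^ i) n"
    using fps_star_nth_eq_partial_sum[OF assms, of n "Suc n"] by simp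
  also have "(\<Sum>i\<le>Suc n. F ^ i) = 1 + F * (\<Sum>i\<le>n. F ^ i)"
    by (simp only: sum.atMost_Suc_shift power_0 power_Suc sum_distrib_left)
  \<comment> \<open>Coefficient \<open>n\<close> of the product sees only degrees \<le>
    \<open>n\<close> of the second factor, and there the partial sum is already exact.\<close>
  also have "fps_nth (F * (\<Sum>i\<le>n. F ^ i)) n = fps_nth (F * fps_star F) n"
    unfolding fps_mult_nth
    by (intro sum.cong refl arg_cong2[where f = "(*)"] fps_star_nth_eq_partial_sum assms) simp
  then have "fps_nth (1 + F * (\<Sum>i\<le>n. F ^ i)) n = fps_nth (1 + F * fps_star F) n"
    by simp
  finally show "fps_nth (fps_star F) n = fps_nth (1 + F * fps_star F) n" .
qed

lemma one_minus_mult_fps_star: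
  fixes F :: "'a::comm_ring_1 fps"
  assumes "fps_nth F 0 = 0"
  shows "(1 - F) * fps_star F = 1"
  using fps_star_unfold[OF assms] by (simp add: algebra_simps)

lemma fps_star_eqI:
  fixes F :: "'a::comm_ring_1 fps"
  assumes "fps_nth F 0 = 0" and "(1 - F) * S = 1"
  shows "fps_star F = S"
proof -
  have "fps_star F = fps_star F * ((1 - F) * S)"
    using assms(2) by simp
  also have "\<dots> = ((1 - F) * fps_star F) * S"
    by (simp only: mult_ac)
  finally show ?thesis
    using one_minus_mult_fps_star[OF assms(1)] by simp
qed

lemma rational_fps_const: "fps_const c \<in> rational_fps"
  using rational_fps.poly[of "[:c:]"] by (simp add: fps_of_poly_const)

lemma rational_fps_uminus:
  fixes F :: "'a::comm_ring_1 fps"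
  assumes "F \<in> rational_fps"
  shows "- F \<in> rational_fps"
  using rational_fps.mult[OF rational_fps_const[of "- 1"] assms]
  by (simp flip: fps_const_neg)

text \<open>In a semiring the constant term cannot be subtracted, so the splitting is built up by
  induction along the rational operations.\<close>

lemma rational_fps_remove_const:
  assumes "F \<in> rational_fps"
  obtains c G where "G \<in> rational_fps" "fps_nth G 0 = 0" "F = fps_const c + G"
proof -
  from assms have "\<exists>c G. G \<in> rational_fps \<and> fps_nth G 0 = 0 \<and> F = fps_const c + G"
  proof induction
    case (poly p)
    obtain a q where p: "p = pCons a q"
      by (cases p)
    have "fps_of_poly p = fps_const a + fps_of_poly (pCons 0 q)"
      by (rule fps_ext) (simp add: p coeff_pCons split: nat.split)
    moreover have "fps_nth (fps_of_poly (pCons 0 q)) 0 = 0"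
      by simp
    ultimately show ?case
      using rational_fps.poly by blast
  next
    case (add F1 F2)
    then obtain c1 G1 c2 G2 where
      "G1 \<in> rational_fps" "fps_nth G1 0 = 0" "F1 = fps_const c1 + G1"
      "G2 \<in> rational_fps" "fps_nth G2 0 = 0" "F2 = fps_const c2 + G2"
      by blast
    then show ?case
      by (intro exI[of _ "c1 + c2"] exI[of _ "G1 + G2"])
        (simp add: rational_fps.add add_ac flip: fps_const_add)
  next
    case (mult F1 F2)
    then obtain c1 G1 c2 G2 where
      "G1 \<in> rational_fps" "fps_nth G1 0 = 0" "F1 = fps_const c1 + G1"
      "G2 \<in> rational_fps" "fps_nth G2 0 = 0" "F2 = fps_const c2 + G2"
      by blast
    then show ?case
      by (intro exI[of _ "c1 * c2"] exI[of _ "fps_const c1 * G2 + G1 * fps_const c2 + G1 * G2"])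
        (simp add: rational_fps.add rational_fps.mult rational_fps_const algebra_simps
          flip: fps_const_mult)
  next
    \<comment> \<open>The equation \<open>fps_star F = 1 + F * fps_star F\<close> is itself the
      splitting, with constant 1.\<close>
    case (star F)
    then have "F * fps_star F \<in> rational_fps" "fps_nth (F * fps_star F) 0 = 0"
      by (simp_all add: rational_fps.mult rational_fps.star)
    moreover have "fps_star F = fps_const 1 + F * fps_star F"
      using fps_star_unfold[OF star.hyps(2)] by simp
    ultimately show ?case
      by blast
  qed
  then show ?thesis
    using that by blast
qed

text \<open>The coefficientwise image under the canonical semiring homomorphism from the naturals;
  it commutes with sum, product and star, hence preserves rationality.\<close>

definition fps_of_nat :: "nat fps \<Rightarrow> 'a::comm_semiring_1 fps" where
  "fps_of_nat F = Abs_fps (\<lambda>n. of_nat (fps_nth F n))"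

lemma fps_of_nat_nth [simp]: "fps_nth (fps_of_nat F) n = of_nat (fps_nth F n)"
  by (simp add: fps_of_nat_def)

lemma fps_of_nat_1 [simp]: "fps_of_nat 1 = 1"
  by (rule fps_ext) simp

lemma fps_of_nat_add: "fps_of_nat (F + G) = fps_of_nat F + fps_of_nat G"
  by (rule fps_ext) simp

lemma fps_of_nat_mult: "fps_of_nat (F * G) = fps_of_nat F * fps_of_nat G"
  by (rule fps_ext) (simp add: fps_mult_nth)

lemma fps_of_nat_power: "fps_of_nat (F ^ n) = fps_of_nat F ^ n"
  by (induction n) (simp_all add: fps_of_nat_mult)

lemma fps_of_nat_star: "fps_of_nat (fps_star F) = fps_star (fps_of_nat F)"
  by (rule fps_ext) (simp add: fps_star_def flip: fps_of_nat_power)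

lemma fps_of_nat_fps_of_poly: "fps_of_nat (fps_of_poly p) = fps_of_poly (map_poly of_nat p)"
  by (rule fps_ext) (simp add: coeff_map_poly)

lemma rational_fps_of_nat:
  assumes "F \<in> rational_fps"
  shows "fps_of_nat F \<in> rational_fps"
  using assms
proof induction
  case (star F)
  then show ?case
    by (simp add: fps_of_nat_star rational_fps.star)
qed (simp_all add: fps_of_nat_fps_of_poly fps_of_nat_add fps_of_nat_mult rational_fps.intros)

text \<open>Since 1/(1 + K) = (1 - K)/(1 - K^2), the star is taken of \<open>K * K\<close>, free of
  signs. The single minus sign on the right separates two terms that make sense over the
  naturals.\<close>

lemma fps_star_diff:
  fixes G H :: "'a::comm_ring_1 fps"
  assumes "fps_nth G 0 = 0" and "fps_nth H 0 = 0"
  defines "K \<equiv> H * fps_star G"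
  shows "fps_star (G - H) = fps_star G * fps_star (K * K) - fps_star G * K * fps_star (K * K)"
proof (rule fps_star_eqI)
  show "fps_nth (G - H) 0 = 0"
    using assms by simp
  have G: "(1 - G) * fps_star G = 1"
    using assms by (simp add: one_minus_mult_fps_star)
  \<comment> \<open>The factor \<open>(1 - G) * fps_star G\<close> is kept intact so that
    \<open>G\<close> rewrites it to 1.\<close>
  have "(1 - (G - H)) * (fps_star G * fps_star (K * K) - fps_star G * K * fps_star (K * K)) =
      ((1 - G) * fps_star G + K) * (1 - K) * fps_star (K * K)"
    unfolding K_def by (simp add: algebra_simps)
  also have "\<dots> = (1 - K * K) * fps_star (K * K)"
    unfolding G by (simp add: algebra_simps)
  also have "\<dots> = 1"
    using assms by (intro one_minus_mult_fps_star) simp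
  finally show "(1 - (G - H)) * (fps_star G * fps_star (K * K) -
      fps_star G * K * fps_star (K * K)) = 1" .
qed

lemma rational_fps_int_diff:
  fixes F :: "int fps"
  assumes "F \<in> rational_fps"
  shows "\<exists>G\<in>rational_fps. \<exists>H\<in>rational_fps. F = fps_of_nat G - fps_of_nat H"
  using assms
proof induction
  case (poly p)
  \<comment> \<open>Positive and negative parts of the coefficients:
    \<open>x = int (nat x) - int (nat (- x))\<close>.\<close>
  have "fps_of_poly p = fps_of_nat (fps_of_poly (map_poly nat p)) -
      fps_of_nat (fps_of_poly (map_poly (\<lambda>x. nat (- x)) p))"
    by (rule fps_ext) (simp add: coeff_map_poly)
  then show ?case
    using rational_fps.poly by blast
next
  case (add F1 F2)
  then obtain G1 H1 G2 H2 where
    "G1 \<in> rational_fps" "H1 \<in> rational_fps" "F1 = fps_of_nat G1 - fps_of_nat H1"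
    "G2 \<in> rational_fps" "H2 \<in> rational_fps" "F2 = fps_of_nat G2 - fps_of_nat H2"
    by blast
  then show ?case
    by (intro bexI[of _ "G1 + G2"] bexI[of _ "H1 + H2"])
      (simp_all add: fps_of_nat_add rational_fps.add)
next
  case (mult F1 F2)
  then obtain G1 H1 G2 H2 where
    "G1 \<in> rational_fps" "H1 \<in> rational_fps" "F1 = fps_of_nat G1 - fps_of_nat H1"
    "G2 \<in> rational_fps" "H2 \<in> rational_fps" "F2 = fps_of_nat G2 - fps_of_nat H2"
    by blast
  \<comment> \<open>The witnesses collect the positive and the negative terms of the expanded
    product.\<close>
  then show ?case
    by (intro bexI[of _ "G1 * G2 + H1 * H2"] bexI[of _ "G1 * H2 + H1 * G2"])
      (simp_all only: fps_of_nat_add fps_of_nat_mult rational_fps.add rational_fps.mult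
        ring_distribs diff_conv_add_uminus minus_add_distrib minus_mult_left[symmetric]
        minus_mult_right[symmetric] minus_minus ac_simps)
next
  case (star F)
  then obtain G' H' where GH': "G' \<in> rational_fps" "H' \<in> rational_fps"
    and F': "F = fps_of_nat G' - fps_of_nat H'"
    by blast
  from GH'(1) obtain c G where G: "G \<in> rational_fps" "fps_nth G 0 = 0" "G' = fps_const c + G"
    by (rule rational_fps_remove_const)
  from GH'(2) obtain d H where H: "H \<in> rational_fps" "fps_nth H 0 = 0" "H' = fps_const d + H"
    by (rule rational_fps_remove_const)
  \<comment> \<open>The constant term of \<open>F\<close> is the difference of \<open>c\<close> and
    \<open>d\<close>, and it is 0 because the star of \<open>F\<close> is formed. So both constants
    cancel and \<open>G\<close>, \<open>H\<close> may replace \<open>G'\<close>,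
    \<open>H'\<close>.\<close>
  have "c = d"
    using star.hyps(2) F' G(2,3) H(2,3) by simp
  then have F: "F = fps_of_nat G - fps_of_nat H"
    unfolding F' G(3) H(3) by (simp add: fps_of_nat_add)
  \<comment> \<open>This \<open>K\<close> lives over the naturals; \<open>fps_of_nat\<close> carries
    it to the auxiliary series of \<open>fps_star_diff\<close>.\<close>
  define K where "K = H * fps_star G"
  have KK: "fps_star (K * K) \<in> rational_fps" and K: "K \<in> rational_fps"
    using G H by (simp_all add: K_def rational_fps.intros)
  have "fps_star F = fps_of_nat (fps_star G * fps_star (K * K)) -
      fps_of_nat (fps_star G * K * fps_star (K * K))"
    unfolding F K_def using G(2) H(2)
    by (subst fps_star_diff) (simp_all add: fps_of_nat_mult fps_of_nat_star)
  moreover have "fps_star G * fps_star (K * K) \<in> rational_fps"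
      "fps_star G * K * fps_star (K * K) \<in> rational_fps"
    using G K KK by (simp_all add: rational_fps.mult rational_fps.star)
  ultimately show ?case
    by blast
qed

theorem corollary11:
  fixes f :: "nat \<Rightarrow> nat"
  shows "rational_fun (\<lambda>n. int (f n)) \<longleftrightarrow>
    (\<exists>f1 f2 :: nat \<Rightarrow> nat. rational_fun f1 \<and> rational_fun f2 \<and>
       (\<forall>n. int (f n) = int (f1 n) - int (f2 n)))"
proof
  assume "rational_fun (\<lambda>n. int (f n))"
  then obtain G H where GH: "G \<in> rational_fps" "H \<in> rational_fps"
    and eq: "Abs_fps (\<lambda>n. int (f n)) = fps_of_nat G - fps_of_nat H"
    unfolding rational_fun_def using rational_fps_int_diff by blast
  have "int (f n) = int (fps_nth G n) - int (fps_nth H n)" for n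
    using arg_cong[OF eq, of "\<lambda>F. fps_nth F n"] by simp
  moreover have "rational_fun (fps_nth G)" "rational_fun (fps_nth H)"
    using GH by (simp_all add: rational_fun_def fps_nth_inverse)
  ultimately show "\<exists>f1 f2 :: nat \<Rightarrow> nat. rational_fun f1 \<and> rational_fun f2 \<and>
       (\<forall>n. int (f n) = int (f1 n) - int (f2 n))"
    by blast
next
  assume "\<exists>f1 f2 :: nat \<Rightarrow> nat. rational_fun f1 \<and> rational_fun f2 \<and>
       (\<forall>n. int (f n) = int (f1 n) - int (f2 n))"
  then obtain f1 f2 :: "nat \<Rightarrow> nat" where rat: "rational_fun f1" "rational_fun f2"
    and eq: "\<And>n. int (f n) = int (f1 n) - int (f2 n)"
    by blast
  \<comment> \<open>The difference is written as a sum with a negative, because negation is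
    multiplication by the constant polynomial -1 and so preserves rationality over the
    integers.\<close>
  have "Abs_fps (\<lambda>n. int (f n)) = fps_of_nat (Abs_fps f1) + - fps_of_nat (Abs_fps f2)"
    by (rule fps_ext) (simp add: eq)
  also have "\<dots> \<in> rational_fps"
    using rat unfolding rational_fun_def
    by (intro rational_fps.add rational_fps_uminus rational_fps_of_nat)
  finally show "rational_fun (\<lambda>n. int (f n))"
    unfolding rational_fun_def .
qed

end
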